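(* Let $r\in\{f,\beta\}$ and $U\in\mathbb U$. Then: (1) $[U]_r=\{M\in\mathcal M\mid M:\langle env^M_\omega\vdash U\rangle\}$; (2) $[U]_r$ is stable under $\beta$-reduction: if $M\in[U]_r$ and $M\rhd_\beta^* N$ then $N\in[U]_r$; (3) $[U]_r$ is stable under $\beta$-expansion: if $M\in[U]_r$ and $N\rhd_\beta^* M$ then $N\in[U]_r$; (4) $[U]_r=\{M\in\mathcal M\mid M\rhd_\beta^* N\text{ for some }N\text{ with }N:\langle env^N_\omega\vdash U\rangle\}$.
   Context: Terms: $\mathcal V$ is a denumerably infinite set of variables; $\mathcal M$ is the set of untyped $\lambda$-terms $M::=x\mid \lambda x.M\mid MM$ taken modulo $\alpha$-conversion; $FV(M)$ is the set of free variables; $M[x:=N]$ is capture-avoiding substitution. $\rhd_\beta$ is the compatible closure of $(\lambda x.M)N\rhd_\beta M[x:=N]$. Weak head reduction: $M\rhd_f N$ iff $M=(\lambda x.P)QQ_1\dots Q_n$ and $N=P[x:=Q]Q_1\dots Q_n$ for some $n\ge 0$. $\rhd_r^*$ is the reflexive-transitive closure of $\rhd_r$. Types: $\mathcal A$ is a denumerably infinite set of atomic types; $\mathbb T::=a\mid \mathbb U\to\mathbb T$ ($a\in\mathcal A$) and $\mathbb U::=\omega\mid \mathbb U\sqcap\mathbb U\mid \mathbb T$; types are quotiented by commutativity, associativity and idempotence of $\sqcap$ and by $\omega\sqcap U=U$. $T$ ranges over $\mathbb T$, $U,V$ over $\mathbb U$. Environments: a type environment is a finite set $(x_i:U_i)_n$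 of declarations with pairwise distinct variables; $dom$ is its set of variables; $\Gamma,x:U$ requires $x\notin dom(\Gamma)$; $env^M_\omega$ assigns $\omega$ to each variable of $FV(M)$ and nothing else; if $\Gamma_1=(x_i:U_i)_n,(y_j:V_j)_m$ and $\Gamma_2=(x_i:U'_i)_n,(z_k:W_k)_l$ with the $y_j$, $z_k$ all distinct, then $\Gamma_1\sqcap\Gamma_2=(x_i:U_i\sqcap U'_i)_n,(y_j:V_j)_m,(z_k:W_k)_l$. Subtyping: $\sqsubseteq$ (on types, on environments, and on typings $\langle\Gamma\vdash U\rangle$) is the least relation closed under: $\Phi\sqsubseteq\Phi$; transitivity; $U_1\sqcap U_2\sqsubseteq U_1$; if $U_1\sqsubseteq V_1$ and $U_2\sqsubseteq V_2$ then $U_1\sqcap U_2\sqsubseteq V_1\sqcap V_2$; if $U_2\sqsubseteq U_1$ and $T_1\sqsubseteq T_2$ then $U_1\to T_1\sqsubseteq U_2\to T_2$; if $U_1\sqsubseteq U_2$ and $x\notin dom(\Gamma)$ then $\Gamma,x:U_1\sqsubseteq\Gamma,x:U_2$; if $U_1\sqsubseteq U_2$ and $\Gamma_2\sqsubseteq\Gamma_1$ then $\langle\Gamma_1\vdash U_1\rangle\sqsubseteq\langle\Gamma_2\vdash U_2\rangle$. Typing rules for $M:\langle\Gamma\vdash U\rangle$: (ax) $x:\langle x:T\vdash T\rangle$ for $T\in\mathbb T$; ($\omega$) $M:\langle env^M_\omega\vdash\omega\rangle$; ($\to_i$) from $M:\langle\Gamma,x:U\vdash T\rangle$ infer $\lambda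 x.M:\langle\Gamma\vdash U\to T\rangle$; ($\to'_i$) from $M:\langle\Gamma\vdash T\rangle$ and $x\notin dom(\Gamma)$ infer $\lambda x.M:\langle\Gamma\vdash\omega\to T\rangle$; ($\to_e$) from $M_1:\langle\Gamma_1\vdash U\to T\rangle$ and $M_2:\langle\Gamma_2\vdash U\rangle$ infer $M_1M_2:\langle\Gamma_1\sqcap\Gamma_2\vdash T\rangle$; ($\sqcap_i$) from $M:\langle\Gamma\vdash U_1\rangle$ and $M:\langle\Gamma\vdash U_2\rangle$ infer $M:\langle\Gamma\vdash U_1\sqcap U_2\rangle$; ($\sqsubseteq$) from $M:\langle\Gamma\vdash U\rangle$ and $\langle\Gamma\vdash U\rangle\sqsubseteq\langle\Gamma'\vdash U'\rangle$ infer $M:\langle\Gamma'\vdash U'\rangle$. Semantics: for $\mathcal X,\mathcal Y\subseteq\mathcal M$, $\mathcal X\leadsto\mathcal Y=\{M\in\mathcal M\mid MN\in\mathcal Y\text{ for all }N\in\mathcal X\}$. For $r\in\{f,\beta\}$, $\mathcal X$ is $r$-saturated if $M\rhd_r^*N$ and $N\in\mathcal X$ imply $M\in\mathcal X$. An $r$-interpretation is a function $\mathcal I:\mathcal A\to\mathcal P(\mathcal M)$ with every $\mathcal I(a)$ $r$-saturated, extended to $\mathbb U$ by $\mathcal I(\omega)=\mathcal M$, $\mathcal I(U_1\sqcap U_2)=\mathcal I(U_1)\cap\mathcal I(U_2)$, $\mathcal I(U\to T)=\mathcal I(U)\leadsto\mathcal I(T)$. The meaning of $U$ is $[U]_r=\bigcap\{\mathcal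 I(U)\mid \mathcal I\text{ an }r\text{-interpretation}\}$. *)

theory Defs
  imports "HOL-Library.Finite_Map"
begin

section \<open>Untyped lambda-terms modulo alpha-conversion\<close>

text \<open>
  Variables are natural numbers.  Terms modulo alpha-conversion are de Bruijn terms: in
  \<open>Bind P\<close> the index \<open>0\<close> of \<open>P\<close> is the bound one and the index \<open>Suc i\<close> denotes the free
  variable \<open>i\<close>.  \<open>Bind\<close> is only used to build the type; everything below is phrased with the
  named abstraction \<open>lam x M\<close> and the named substitution \<open>M[x ::= N]\<close>, whose usual laws
  (alpha-conversion, capture-avoidance, every term is a variable, an application or an
  abstraction over an arbitrary fresh variable) are proved at the end of this section.
\<close>

datatype trm = Var nat | App trm trm | Bind trm

primrec fv :: "trm \<Rightarrow> nat set" where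
  "fv (Var x) = {x}"
| "fv (App M N) = fv M \<union> fv N"
| "fv (Bind P) = {i. Suc i \<in> fv P}"

primrec rename :: "(nat \<Rightarrow> nat) \<Rightarrow> trm \<Rightarrow> trm" where
  "rename f (Var x) = Var (f x)"
| "rename f (App M N) = App (rename f M) (rename f N)"
| "rename f (Bind P) = Bind (rename (case_nat 0 (\<lambda>i. Suc (f i))) P)"

primrec psubst :: "(nat \<Rightarrow> trm) \<Rightarrow> trm \<Rightarrow> trm" where
  "psubst s (Var x) = s x"
| "psubst s (App M N) = App (psubst s M) (psubst s N)"
| "psubst s (Bind P) = Bind (psubst (case_nat (Var 0) (\<lambda>i. rename Suc (s i))) P)"

definition subst :: "trm \<Rightarrow> nat \<Rightarrow> trm \<Rightarrow> trm"  ("_[_ ::= _]" [900, 0, 0] 900) where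
  "M[x ::= N] = psubst (Var(x := N)) M"

definition lam :: "nat \<Rightarrow> trm \<Rightarrow> trm" where
  "lam x M = Bind (rename (\<lambda>i. if i = x then 0 else Suc i) M)"

lemma fv_rename: "fv (rename f M) = f ` fv M"
proof (induction M arbitrary: f)
  case (Bind P)
  show ?case
    by (auto simp: Bind split: nat.splits intro: rev_image_eqI)
qed auto

lemma rename_cong: "(\<And>i. i \<in> fv M \<Longrightarrow> f i = g i) \<Longrightarrow> rename f M = rename g M"
proof (induction M arbitrary: f g)
  case (App M N)
  have "rename f M = rename g M" by (rule App.IH) (simp add: App.prems)
  moreover have "rename f N = rename g N" by (rule App.IH) (simp add: App.prems)
  ultimately show ?case by simp
next
  case (Bind P)
  show ?case by (auto intro!: Bind.IH Bind.prems split: nat.splits)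
qed simp

lemma psubst_cong: "(\<And>i. i \<in> fv M \<Longrightarrow> s i = t i) \<Longrightarrow> psubst s M = psubst t M"
proof (induction M arbitrary: s t)
  case (App M N)
  have "psubst s M = psubst t M" by (rule App.IH) (simp add: App.prems)
  moreover have "psubst s N = psubst t N" by (rule App.IH) (simp add: App.prems)
  ultimately show ?case by simp
next
  case (Bind P)
  show ?case by (auto intro!: Bind.IH arg_cong[of _ _ "rename _"] Bind.prems split: nat.splits)
qed simp

lemma rename_rename: "rename f (rename g M) = rename (\<lambda>i. f (g i)) M"
  by (induction M arbitrary: f g) (auto intro!: rename_cong split: nat.splits)

lemma rename_ident: "rename (\<lambda>i. i) M = M"
proof -
  have "(case_nat 0 Suc) = (\<lambda>i. i)" by (auto split: nat.splits)
  then show ?thesis by (induction M) auto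
qed

lemma psubst_Var_rename: "psubst (\<lambda>i. Var (f i)) M = rename f M"
proof (induction M arbitrary: f)
  case (Bind P)
  have "(case_nat (Var 0) (\<lambda>i. rename Suc (Var (f i)))) = (\<lambda>i. Var (case_nat 0 (\<lambda>i. Suc (f i)) i))"
    by (auto split: nat.splits)
  then show ?case by (simp only: psubst.simps rename.simps Bind)
qed auto

lemma psubst_rename: "psubst s (rename f M) = psubst (\<lambda>i. s (f i)) M"
  by (induction M arbitrary: s f) (auto intro!: psubst_cong split: nat.splits)

lemma rename_psubst: "rename f (psubst s M) = psubst (\<lambda>i. rename f (s i)) M"
proof (induction M arbitrary: s f)
  case (Bind P)
  show ?case by (auto simp: Bind rename_rename intro!: psubst_cong split: nat.splits)
qed auto

lemma finite_fv: "finite (fv M)"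
proof (induction M)
  case (Bind P)
  then have "finite (Suc -` fv P)" by (intro finite_vimageI) auto
  then show ?case by (simp add: vimage_def)
qed auto

lemma fv_lam: "fv (lam x M) = fv M - {x}"
  by (auto simp: lam_def fv_rename split: if_splits)

lemma lam_inject: "lam x M = lam x N \<longleftrightarrow> M = N"
proof
  let ?f = "\<lambda>i. if i = x then 0 else Suc i" and ?g = "case_nat x (\<lambda>i. i)"
  assume "lam x M = lam x N"
  then have "rename ?g (rename ?f M) = rename ?g (rename ?f N)" by (simp add: lam_def)
  moreover have "rename ?g (rename ?f L) = L" for L
  proof -
    have "(\<lambda>i. ?g (?f i)) = (\<lambda>i. i)" by auto
    then show ?thesis by (simp only: rename_rename rename_ident)
  qed
  ultimately show "M = N" by simp
qed simp

lemma subst_Var_rename: "M[x ::= Var y] = rename (\<lambda>i. if i = x then y else i) M"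
  unfolding subst_def psubst_Var_rename[symmetric] by (rule psubst_cong) auto

lemma lam_alpha: "y \<notin> fv M \<Longrightarrow> lam y (M[x ::= Var y]) = lam x M"
  unfolding lam_def subst_Var_rename rename_rename by (auto intro!: rename_cong)

lemma subst_Var [simp]: "(Var y)[x ::= N] = (if y = x then N else Var y)"
  by (simp add: subst_def)

lemma subst_App [simp]: "(App M1 M2)[x ::= N] = App (M1[x ::= N]) (M2[x ::= N])"
  by (simp add: subst_def)

lemma subst_lam [simp]: "y \<noteq> x \<Longrightarrow> y \<notin> fv N \<Longrightarrow> (lam y M)[x ::= N] = lam y (M[x ::= N])"
  unfolding subst_def lam_def psubst.simps psubst_rename rename_psubst trm.inject
  by (rule psubst_cong) (auto intro!: rename_cong)

lemma trm_named_exhaust: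
  assumes "finite A"
  obtains x where "t = Var x" | M N where "t = App M N" | x M where "x \<notin> A" "t = lam x M"
proof (cases t)
  case (Bind P)
  obtain x where x: "x \<notin> A" "x \<notin> fv t"
    using ex_new_if_finite[of "A \<union> fv t"] assms finite_fv by auto
  have "t = lam x (rename (case_nat x (\<lambda>i. i)) P)"
    unfolding lam_def rename_rename Bind trm.inject
    by (subst rename_ident[symmetric], rule rename_cong) (use x Bind in \<open>auto split: nat.splits\<close>)
  with x that show thesis by blast
qed (use that in auto)


section \<open>Reduction\<close>

inductive beta :: "trm \<Rightarrow> trm \<Rightarrow> bool" where
  beta_redex: "beta (App (lam x M) N) (M[x ::= N])"
| beta_lam: "beta M M' \<Longrightarrow> beta (lam x M) (lam x M')"
| beta_appL: "beta M M' \<Longrightarrow> beta (App M N) (App M' N)"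
| beta_appR: "beta N N' \<Longrightarrow> beta (App M N) (App M N')"

definition whead :: "trm \<Rightarrow> trm \<Rightarrow> bool" where
  "whead M N \<longleftrightarrow> (\<exists>x P Q Qs. M = foldl App (App (lam x P) Q) Qs \<and> N = foldl App (P[x ::= Q]) Qs)"

datatype red = F | B

primrec step :: "red \<Rightarrow> trm \<Rightarrow> trm \<Rightarrow> bool" where
  "step F = whead"
| "step B = beta"

abbreviation steps :: "red \<Rightarrow> trm \<Rightarrow> trm \<Rightarrow> bool" where
  "steps r \<equiv> (step r)\<^sup>*\<^sup>*"


section \<open>Types\<close>

text \<open>
  The types of \<open>\<bbbU>\<close>, taken modulo associativity, commutativity and idempotence of intersection
  and neutrality of omega, are the finite sets of types of \<open>\<bbbT>\<close>: omega is the empty set,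
  intersection is union, and the inclusion of \<open>\<bbbT>\<close> into \<open>\<bbbU>\<close> forms singletons.  That this
  is exactly the quotient of the raw syntax is the content of the theorems
  \<open>eq_tty_iff\<close>, \<open>eq_uty_iff\<close>, \<open>tty_of_surj\<close> and \<open>uty_of_surj\<close> below.
\<close>

datatype tty = Atom nat | Arr "tty fset" tty

type_synonym uty = "tty fset"

abbreviation (input) omega :: uty  ("\<omega>") where "\<omega> \<equiv> {||}"
abbreviation inter :: "uty \<Rightarrow> uty \<Rightarrow> uty"  (infixl "\<sqinter>\<^sub>u" 70) where "U \<sqinter>\<^sub>u V \<equiv> U |\<union>| V"
abbreviation ty :: "tty \<Rightarrow> uty" where "ty T \<equiv> {|T|}"

datatype raw_tty = RAtom nat | RArr raw_uty raw_tty
  and raw_uty = ROmega | RInter raw_uty raw_uty | RTy raw_tty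

inductive eq_tty :: "raw_tty \<Rightarrow> raw_tty \<Rightarrow> bool" and eq_uty :: "raw_uty \<Rightarrow> raw_uty \<Rightarrow> bool" where
  "eq_tty t t"
| "eq_tty s t \<Longrightarrow> eq_tty t s"
| "eq_tty s t \<Longrightarrow> eq_tty t t' \<Longrightarrow> eq_tty s t'"
| "eq_uty u v \<Longrightarrow> eq_tty s t \<Longrightarrow> eq_tty (RArr u s) (RArr v t)"
| "eq_uty u u"
| "eq_uty u v \<Longrightarrow> eq_uty v u"
| "eq_uty u v \<Longrightarrow> eq_uty v w \<Longrightarrow> eq_uty u w"
| "eq_tty s t \<Longrightarrow> eq_uty (RTy s) (RTy t)"
| "eq_uty u u' \<Longrightarrow> eq_uty v v' \<Longrightarrow> eq_uty (RInter u v) (RInter u' v')"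
| "eq_uty (RInter u v) (RInter v u)"
| "eq_uty (RInter u (RInter v w)) (RInter (RInter u v) w)"
| "eq_uty (RInter u u) u"
| "eq_uty (RInter ROmega u) u"

primrec tty_of :: "raw_tty \<Rightarrow> tty" and uty_of :: "raw_uty \<Rightarrow> uty" where
  "tty_of (RAtom a) = Atom a"
| "tty_of (RArr u t) = Arr (uty_of u) (tty_of t)"
| "uty_of ROmega = \<omega>"
| "uty_of (RInter u v) = uty_of u \<sqinter>\<^sub>u uty_of v"
| "uty_of (RTy t) = ty (tty_of t)"

lemma eq_imp_of:
  "eq_tty s t \<Longrightarrow> tty_of s = tty_of t"
  "eq_uty u v \<Longrightarrow> uty_of u = uty_of v"
  by (induction rule: eq_tty_eq_uty.inducts) auto

definition big_inter :: "raw_tty list \<Rightarrow> raw_uty" where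
  "big_inter ts = foldr (\<lambda>t. RInter (RTy t)) ts ROmega"

lemma big_inter_simps [simp]:
  "big_inter [] = ROmega" "big_inter (t # ts) = RInter (RTy t) (big_inter ts)"
  by (simp_all add: big_inter_def)

lemmas eq_uty_refl = eq_tty_eq_uty.intros(5)
lemmas eq_uty_sym = eq_tty_eq_uty.intros(6)
lemmas eq_uty_trans [trans] = eq_tty_eq_uty.intros(7)
lemmas eq_uty_cong = eq_tty_eq_uty.intros(9)
lemmas eq_uty_comm = eq_tty_eq_uty.intros(10)
lemmas eq_uty_assoc = eq_tty_eq_uty.intros(11)
lemmas eq_uty_idem = eq_tty_eq_uty.intros(12)
lemmas eq_uty_unit = eq_tty_eq_uty.intros(13)

lemma big_inter_append: "eq_uty (RInter (big_inter ss) (big_inter ts)) (big_inter (ss @ ts))"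
proof (induction ss)
  case Nil
  show ?case by (simp add: eq_uty_unit)
next
  case (Cons s ss)
  have "eq_uty (RInter (RInter (RTy s) (big_inter ss)) (big_inter ts))
      (RInter (RTy s) (RInter (big_inter ss) (big_inter ts)))"
    by (rule eq_uty_sym, rule eq_uty_assoc)
  also have "eq_uty \<dots> (RInter (RTy s) (big_inter (ss @ ts)))"
    by (intro eq_uty_cong eq_uty_refl Cons.IH)
  finally show ?case by simp
qed

lemma big_inter_absorb:
  "t \<in> set ts \<Longrightarrow> eq_uty (RInter (RTy t) (big_inter ts)) (big_inter ts)"
proof (induction ts)
  case (Cons s ts)
  show ?case
  proof (cases "s = t")
    case True
    have "eq_uty (RInter (RTy t) (RInter (RTy t) (big_inter ts)))
        (RInter (RInter (RTy t) (RTy t)) (big_inter ts))"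
      by (rule eq_uty_assoc)
    also have "eq_uty \<dots> (RInter (RTy t) (big_inter ts))"
      by (intro eq_uty_cong eq_uty_idem eq_uty_refl)
    finally show ?thesis using True by simp
  next
    case False
    have "eq_uty (RInter (RTy t) (RInter (RTy s) (big_inter ts)))
        (RInter (RInter (RTy t) (RTy s)) (big_inter ts))"
      by (rule eq_uty_assoc)
    also have "eq_uty \<dots> (RInter (RInter (RTy s) (RTy t)) (big_inter ts))"
      by (intro eq_uty_cong eq_uty_comm eq_uty_refl)
    also have "eq_uty \<dots> (RInter (RTy s) (RInter (RTy t) (big_inter ts)))"
      by (rule eq_uty_sym, rule eq_uty_assoc)
    also have "eq_uty \<dots> (RInter (RTy s) (big_inter ts))"
      using Cons False by (intro eq_uty_cong eq_uty_refl) auto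
    finally show ?thesis by simp
  qed
qed simp

lemma big_inter_subset:
  "set ss \<subseteq> set ts \<Longrightarrow> eq_uty (RInter (big_inter ss) (big_inter ts)) (big_inter ts)"
proof (induction ss)
  case Nil
  show ?case by (simp add: eq_uty_unit)
next
  case (Cons s ss)
  have "eq_uty (RInter (RInter (RTy s) (big_inter ss)) (big_inter ts))
      (RInter (RTy s) (RInter (big_inter ss) (big_inter ts)))"
    by (rule eq_uty_sym, rule eq_uty_assoc)
  also have "eq_uty \<dots> (RInter (RTy s) (big_inter ts))"
    using Cons by (intro eq_uty_cong eq_uty_refl) auto
  also have "eq_uty \<dots> (big_inter ts)"
    using Cons.prems by (intro big_inter_absorb) auto
  finally show ?case by simp
qed

lemma big_inter_set_eq:
  assumes "set ss = set ts"
  shows "eq_uty (big_inter ss) (big_inter ts)"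
proof -
  have "eq_uty (big_inter ss) (RInter (big_inter ts) (big_inter ss))"
    using assms by (intro eq_uty_sym[OF big_inter_subset]) auto
  also have "eq_uty \<dots> (RInter (big_inter ss) (big_inter ts))"
    by (rule eq_uty_comm)
  also have "eq_uty \<dots> (big_inter ts)"
    using assms by (intro big_inter_subset) auto
  finally show ?thesis .
qed

definition raw_of_fset :: "raw_tty fset \<Rightarrow> raw_uty" where
  "raw_of_fset S = big_inter (SOME ts. set ts = fset S)"

lemma raw_of_fset: "set ts = fset S \<Longrightarrow> eq_uty (raw_of_fset S) (big_inter ts)"
  unfolding raw_of_fset_def
  by (rule big_inter_set_eq) (metis (mono_tags, lifting) someI)

primrec raw_of :: "tty \<Rightarrow> raw_tty" where
  "raw_of (Atom a) = RAtom a"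
| "raw_of (Arr U T) = RArr (raw_of_fset (raw_of |`| U)) (raw_of T)"

lemma eq_raw_of:
  "eq_tty t (raw_of (tty_of t))"
  "eq_uty u (raw_of_fset (raw_of |`| uty_of u))"
proof (induction t and u)
  case ROmega
  show ?case using raw_of_fset[of "[]" "{||}"] by (auto intro: eq_uty_sym)
next
  case (RTy t)
  have "eq_uty (RTy t) (RTy (raw_of (tty_of t)))"
    using RTy by (rule eq_tty_eq_uty.intros)
  also have "eq_uty \<dots> (RInter ROmega (RTy (raw_of (tty_of t))))"
    by (rule eq_uty_sym, rule eq_uty_unit)
  also have "eq_uty \<dots> (RInter (RTy (raw_of (tty_of t))) ROmega)"
    by (rule eq_uty_comm)
  also have "eq_uty \<dots> (raw_of_fset (raw_of |`| uty_of (RTy t)))"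
    using raw_of_fset[of "[raw_of (tty_of t)]" "raw_of |`| uty_of (RTy t)"]
    by (auto intro: eq_uty_sym)
  finally show ?case .
next
  case (RInter u v)
  obtain us vs where us: "set us = fset (raw_of |`| uty_of u)" and vs: "set vs = fset (raw_of |`| uty_of v)"
    by (meson finite_list finite_fset)
  have "eq_uty (RInter u v) (RInter (big_inter us) (big_inter vs))"
    using RInter us vs by (blast intro: eq_uty_cong eq_uty_trans raw_of_fset)
  also have "eq_uty \<dots> (big_inter (us @ vs))"
    by (rule big_inter_append)
  also have "eq_uty \<dots> (raw_of_fset (raw_of |`| uty_of (RInter u v)))"
    by (rule eq_uty_sym, rule raw_of_fset) (use us vs in auto)
  finally show ?case .
qed (auto intro: eq_tty_eq_uty.intros)

theorem eq_tty_iff: "eq_tty s t \<longleftrightarrow> tty_of s = tty_of t"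
  by (metis eq_imp_of(1) eq_raw_of(1) eq_tty_eq_uty.intros(2,3))

theorem eq_uty_iff: "eq_uty u v \<longleftrightarrow> uty_of u = uty_of v"
  by (metis eq_imp_of(2) eq_raw_of(2) eq_uty_sym eq_uty_trans)

lemma uty_of_big_inter: "uty_of (big_inter ts) = fset_of_list (map tty_of ts)"
  by (induction ts) auto

lemma tty_of_raw_of: "tty_of (raw_of T) = T"
proof (induction T)
  case (Arr U T)
  obtain ts where ts: "set ts = fset (raw_of |`| U)"
    by (meson finite_list finite_fset)
  have "uty_of (raw_of_fset (raw_of |`| U)) = uty_of (big_inter ts)"
    by (rule eq_imp_of(2), rule raw_of_fset, rule ts)
  also have "\<dots> = U"
    using ts Arr by (auto simp: uty_of_big_inter fset_eq_iff fset_of_list_elem fset_of_list.rep_eq image_image)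
  finally show ?case using Arr by simp
qed simp

theorem tty_of_surj: "surj tty_of"
  by (metis surjI tty_of_raw_of)

theorem uty_of_surj: "surj uty_of"
  unfolding surj_def
proof
  fix U :: uty
  obtain ts where ts: "set ts = fset U"
    by (meson finite_list finite_fset)
  then have "U = uty_of (big_inter (map raw_of ts))"
    by (auto simp: uty_of_big_inter fset_eq_iff fset_of_list_elem fset_of_list.rep_eq tty_of_raw_of image_image)
  then show "\<exists>u. U = uty_of u" ..
qed


section \<open>Type environments\<close>

type_synonym env = "(nat, uty) fmap"

context includes fmap.lifting
begin

lift_definition env_omega :: "trm \<Rightarrow> env" is
  "\<lambda>M x. if x \<in> fv M then Some \<omega> else None"
  by (auto simp: dom_def finite_fv)

lift_definition env_inter :: "env \<Rightarrow> env \<Rightarrow> env"  (infixl "\<sqinter>\<^sub>e" 70) is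
  "\<lambda>\<Gamma>1 \<Gamma>2 x. case \<Gamma>1 x of
      None \<Rightarrow> \<Gamma>2 x
    | Some U \<Rightarrow> (case \<Gamma>2 x of None \<Rightarrow> Some U | Some V \<Rightarrow> Some (U \<sqinter>\<^sub>u V))"
  subgoal for \<Gamma>1 \<Gamma>2
    by (rule finite_subset[of _ "dom \<Gamma>1 \<union> dom \<Gamma>2"]) (auto split: option.splits)
  done

end


section \<open>Subtyping\<close>

text \<open>
  The single relation on types, environments and typings is split by sort, so reflexivity and
  transitivity occur once per sort.  The pair \<open>(\<Gamma>, U)\<close> stands for the typing with
  environment \<open>\<Gamma>\<close> and type \<open>U\<close>.
\<close>

inductive sub :: "uty \<Rightarrow> uty \<Rightarrow> bool"  (infix "\<sqsubseteq>\<^sub>u" 50) where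
  sub_refl: "U \<sqsubseteq>\<^sub>u U"
| sub_trans: "U1 \<sqsubseteq>\<^sub>u U2 \<Longrightarrow> U2 \<sqsubseteq>\<^sub>u U3 \<Longrightarrow> U1 \<sqsubseteq>\<^sub>u U3"
| sub_interE: "U1 \<sqinter>\<^sub>u U2 \<sqsubseteq>\<^sub>u U1"
| sub_inter: "U1 \<sqsubseteq>\<^sub>u V1 \<Longrightarrow> U2 \<sqsubseteq>\<^sub>u V2 \<Longrightarrow> U1 \<sqinter>\<^sub>u U2 \<sqsubseteq>\<^sub>u V1 \<sqinter>\<^sub>u V2"
| sub_arr: "U2 \<sqsubseteq>\<^sub>u U1 \<Longrightarrow> ty T1 \<sqsubseteq>\<^sub>u ty T2 \<Longrightarrow> ty (Arr U1 T1) \<sqsubseteq>\<^sub>u ty (Arr U2 T2)"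

inductive sub_env :: "env \<Rightarrow> env \<Rightarrow> bool"  (infix "\<sqsubseteq>\<^sub>e" 50) where
  sub_env_refl: "\<Gamma> \<sqsubseteq>\<^sub>e \<Gamma>"
| sub_env_trans: "\<Gamma>1 \<sqsubseteq>\<^sub>e \<Gamma>2 \<Longrightarrow> \<Gamma>2 \<sqsubseteq>\<^sub>e \<Gamma>3 \<Longrightarrow> \<Gamma>1 \<sqsubseteq>\<^sub>e \<Gamma>3"
| sub_env_upd: "U1 \<sqsubseteq>\<^sub>u U2 \<Longrightarrow> x |\<notin>| fmdom \<Gamma> \<Longrightarrow> fmupd x U1 \<Gamma> \<sqsubseteq>\<^sub>e fmupd x U2 \<Gamma>"

inductive sub_typing :: "env \<times> uty \<Rightarrow> env \<times> uty \<Rightarrow> bool"  (infix "\<sqsubseteq>\<^sub>t" 50) where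
  sub_typing_refl: "\<Phi> \<sqsubseteq>\<^sub>t \<Phi>"
| sub_typing_trans: "\<Phi>1 \<sqsubseteq>\<^sub>t \<Phi>2 \<Longrightarrow> \<Phi>2 \<sqsubseteq>\<^sub>t \<Phi>3 \<Longrightarrow> \<Phi>1 \<sqsubseteq>\<^sub>t \<Phi>3"
| sub_typing_pair: "U1 \<sqsubseteq>\<^sub>u U2 \<Longrightarrow> \<Gamma>2 \<sqsubseteq>\<^sub>e \<Gamma>1 \<Longrightarrow> (\<Gamma>1, U1) \<sqsubseteq>\<^sub>t (\<Gamma>2, U2)"


section \<open>Typing\<close>

inductive typing :: "trm \<Rightarrow> env \<Rightarrow> uty \<Rightarrow> bool"  ("_ : \<langle>_ \<turnstile> _\<rangle>" [60, 60, 60] 50) where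
  typing_ax: "Var x : \<langle>fmupd x (ty T) fmempty \<turnstile> ty T\<rangle>"
| typing_omega: "M : \<langle>env_omega M \<turnstile> \<omega>\<rangle>"
| typing_arrI: "M : \<langle>fmupd x U \<Gamma> \<turnstile> ty T\<rangle> \<Longrightarrow> x |\<notin>| fmdom \<Gamma> \<Longrightarrow> lam x M : \<langle>\<Gamma> \<turnstile> ty (Arr U T)\<rangle>"
| typing_arrI': "M : \<langle>\<Gamma> \<turnstile> ty T\<rangle> \<Longrightarrow> x |\<notin>| fmdom \<Gamma> \<Longrightarrow> lam x M : \<langle>\<Gamma> \<turnstile> ty (Arr \<omega> T)\<rangle>"
| typing_arrE: "M1 : \<langle>\<Gamma>1 \<turnstile> ty (Arr U T)\<rangle> \<Longrightarrow> M2 : \<langle>\<Gamma>2 \<turnstile> U\<rangle> \<Longrightarrow> App M1 M2 : \<langle>\<Gamma>1 \<sqinter>\<^sub>e \<Gamma>2 \<turnstile> ty T\<rangle>"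
| typing_interI: "M : \<langle>\<Gamma> \<turnstile> U1\<rangle> \<Longrightarrow> M : \<langle>\<Gamma> \<turnstile> U2\<rangle> \<Longrightarrow> M : \<langle>\<Gamma> \<turnstile> U1 \<sqinter>\<^sub>u U2\<rangle>"
| typing_sub: "M : \<langle>\<Gamma> \<turnstile> U\<rangle> \<Longrightarrow> (\<Gamma>, U) \<sqsubseteq>\<^sub>t (\<Gamma>', U') \<Longrightarrow> M : \<langle>\<Gamma>' \<turnstile> U'\<rangle>"


section \<open>Semantics\<close>

definition arrow :: "trm set \<Rightarrow> trm set \<Rightarrow> trm set"  (infixr "\<leadsto>" 60) where
  "X \<leadsto> Y = {M. \<forall>N\<in>X. App M N \<in> Y}"

definition saturated :: "red \<Rightarrow> trm set \<Rightarrow> bool" where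
  "saturated r X \<longleftrightarrow> (\<forall>M N. steps r M N \<longrightarrow> N \<in> X \<longrightarrow> M \<in> X)"

definition interpretation_for :: "red \<Rightarrow> (nat \<Rightarrow> trm set) \<Rightarrow> bool" where
  "interpretation_for r I \<longleftrightarrow> (\<forall>a. saturated r (I a))"

primrec interp_tty :: "(nat \<Rightarrow> trm set) \<Rightarrow> tty \<Rightarrow> trm set" where
  "interp_tty I (Atom a) = I a"
| "interp_tty I (Arr U T) = \<Inter> (fset (interp_tty I |`| U)) \<leadsto> interp_tty I T"

definition interp :: "(nat \<Rightarrow> trm set) \<Rightarrow> uty \<Rightarrow> trm set" where
  "interp I U = \<Inter> (fset (interp_tty I |`| U))"

text \<open>The empty intersection is the set of all terms, so these are the usual clauses:\<close>

lemma interp_simps: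
  "interp I (ty (Atom a)) = I a"
  "interp I \<omega> = UNIV"
  "interp I (U \<sqinter>\<^sub>u V) = interp I U \<inter> interp I V"
  "interp I (ty (Arr U T)) = interp I U \<leadsto> interp I (ty T)"
  by (auto simp: interp_def)

definition meaning :: "red \<Rightarrow> uty \<Rightarrow> trm set" where
  "meaning r U = \<Inter> {interp I U | I. interpretation_for r I}"

end

theory Submission
  imports Defs "HOL-Library.Countable"
begin

text \<open>
  Reading an environment as a total map \<open>\<rho>\<close> with default \<open>\<omega>\<close>, the types of a term form a
  filter \<open>types_of M \<rho>\<close> defined by recursion on the term, which makes the generation lemmas
  definitional.  This filter is invariant under \<open>\<beta>\<close>-conversion.  For completeness, take \<open>\<rho>\<close>
  to be \<open>\<omega>\<close> on the free variables of the given term and to hit every type elsewhere, and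
  interpret an atom \<open>a\<close> by the terms having type \<open>a\<close> under \<open>\<rho>\<close>.  Every type \<open>U\<close> is
  then interpreted by the terms having type \<open>U\<close> under \<open>\<rho>\<close>: for an arrow \<open>U \<rightarrow> T\<close>, apply the
  term to a variable of type \<open>U\<close>.
\<close>

section \<open>Subtyping\<close>

lemma sub_fsubset: "V |\<subseteq>| U \<Longrightarrow> U \<sqsubseteq>\<^sub>u V"
  using sub_interE[of V U] by (simp add: sup.absorb2)

lemma sub_member: "T |\<in>| U \<Longrightarrow> U \<sqsubseteq>\<^sub>u ty T"
  by (rule sub_fsubset) auto

lemma sub_union: "W \<sqsubseteq>\<^sub>u U \<Longrightarrow> W \<sqsubseteq>\<^sub>u V \<Longrightarrow> W \<sqsubseteq>\<^sub>u U |\<union>| V"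
  using sub_inter[of W U W V] by simp

lemma sub_all: "(\<And>T. T |\<in>| V \<Longrightarrow> U \<sqsubseteq>\<^sub>u ty T) \<Longrightarrow> U \<sqsubseteq>\<^sub>u V"
proof (induction V)
  case empty
  show ?case by (rule sub_fsubset) auto
next
  case (insert T V)
  have "U \<sqsubseteq>\<^sub>u ty T |\<union>| V"
    by (intro sub_union insert) (auto intro: insert.prems)
  then show ?case by simp
qed

text \<open>Every subtyping rule lets each component on the right descend from a single component on
  the left. This reduces closure of a filter under subtyping to comparisons of singletons.\<close>

lemma sub_componentE:
  assumes "U \<sqsubseteq>\<^sub>u V" "T' |\<in>| V"
  obtains T where "T |\<in>| U" "ty T \<sqsubseteq>\<^sub>u ty T'"
proof -
  have "\<exists>T. T |\<in>| U \<and> ty T \<sqsubseteq>\<^sub>u ty T'"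
    using assms
  proof (induction arbitrary: T')
    case (sub_trans U1 U2 U3)
    then show ?case by (meson sub.sub_trans)
  qed (auto intro: sub.intros)
  then show thesis using that by blast
qed

text \<open>Direct induction fails at transitivity, where the middle type may be any finite set. The
  induction therefore follows every component of the right-hand type.\<close>

lemma sub_ArrE:
  assumes "ty (Arr U T) \<sqsubseteq>\<^sub>u ty T'"
  obtains U' T'' where "T' = Arr U' T''" "U' \<sqsubseteq>\<^sub>u U" "ty T \<sqsubseteq>\<^sub>u ty T''"
proof -
  \<comment> \<open>\<open>le\<close> packages the desired inversion and is vacuous when
    \<open>S\<close> is an atom; being reflexive and transitive, it survives the rules for
    reflexivity and transitivity.\<close>
  define le where "le S S' \<longleftrightarrow>
      (\<forall>U T. S = Arr U T \<longrightarrow> (\<exists>U' T'. S' = Arr U' T' \<and> U' \<sqsubseteq>\<^sub>u U \<and> ty T \<sqsubseteq>\<^sub>u ty T'))" for S S'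
  have le_refl: "le S S" for S by (auto simp: le_def intro: sub_refl)
  have le_trans: "le S S' \<Longrightarrow> le S' S'' \<Longrightarrow> le S S''" for S S' S''
  proof -
    assume a: "le S S'" and b: "le S' S''"
    show ?thesis
      unfolding le_def
    proof (intro allI impI)
      fix U T assume "S = Arr U T"
      then obtain U' T' where 1: "S' = Arr U' T'" "U' \<sqsubseteq>\<^sub>u U" "ty T \<sqsubseteq>\<^sub>u ty T'"
        using a by (auto simp: le_def)
      then obtain U'' T'' where 2: "S'' = Arr U'' T''" "U'' \<sqsubseteq>\<^sub>u U'" "ty T' \<sqsubseteq>\<^sub>u ty T''"
        using b by (auto simp: le_def)
      have "U'' \<sqsubseteq>\<^sub>u U" by (rule sub_trans[OF 2(2) 1(2)])
      moreover have "ty T \<sqsubseteq>\<^sub>u ty T''" by (rule sub_trans[OF 1(3) 2(3)])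
      ultimately show "\<exists>U' T'. S'' = Arr U' T' \<and> U' \<sqsubseteq>\<^sub>u U \<and> ty T \<sqsubseteq>\<^sub>u ty T'"
        using 2(1) by (intro exI[of _ U''] exI[of _ T'']) simp
    qed
  qed
  have "\<forall>S'. S' |\<in>| W \<longrightarrow> (\<exists>S. S |\<in>| V \<and> le S S')" if "V \<sqsubseteq>\<^sub>u W" for V W
    using that
  proof induction
    case (sub_trans U1 U2 U3)
    then show ?case by (meson le_trans)
  next
    case (sub_arr U2 U1 T1 T2)
    then have "le (Arr U1 T1) (Arr U2 T2)" by (simp add: le_def)
    then show ?case by auto
  next
    case (sub_inter U1 V1 U2 V2)
    then show ?case by (metis funion_iff)
  qed (auto intro: le_refl)
  from this[OF assms] show thesis using that by (auto simp: le_def)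
qed


section \<open>The filter of types of a term\<close>

text \<open>The rule for \<open>\<omega>\<close> is hidden in the application clause: for empty
  \<open>U\<close> nothing is asked of \<open>N\<close>. In the last clause
  \<open>case_nat U \<rho>\<close> gives the bound index 0 the type \<open>U\<close>.\<close>

primrec types_of :: "trm \<Rightarrow> (nat \<Rightarrow> uty) \<Rightarrow> tty set" where
  "types_of (Var x) \<rho> = {T. \<rho> x \<sqsubseteq>\<^sub>u ty T}"
| "types_of (App M N) \<rho> = {T. \<exists>U. Arr U T \<in> types_of M \<rho> \<and> fset U \<subseteq> types_of N \<rho>}"
| "types_of (Bind P) \<rho> = {Arr U T | U T. T \<in> types_of P (case_nat U \<rho>)}"

lemma types_of_mono:
  "(\<And>x. x \<in> fv M \<Longrightarrow> \<rho> x \<sqsubseteq>\<^sub>u \<sigma> x) \<Longrightarrow> types_of M \<sigma> \<subseteq> types_of M \<rho>"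
proof (induction M arbitrary: \<rho> \<sigma>)
  case (Var x)
  then show ?case by (auto intro: sub_trans)
next
  case (App M N)
  have "types_of M \<sigma> \<subseteq> types_of M \<rho>" "types_of N \<sigma> \<subseteq> types_of N \<rho>"
    using App.prems by (auto intro!: App.IH)
  then show ?case by fastforce
next
  case (Bind P)
  have "types_of P (case_nat U \<sigma>) \<subseteq> types_of P (case_nat U \<rho>)" for U
    using Bind.prems by (intro Bind.IH) (auto intro: sub_refl split: nat.splits)
  then show ?case by auto
qed

lemma types_of_cong:
  "(\<And>x. x \<in> fv M \<Longrightarrow> \<rho> x = \<sigma> x) \<Longrightarrow> types_of M \<rho> = types_of M \<sigma>"
  by (intro equalityI types_of_mono) (auto intro: sub_refl)

text \<open>For an application, subtyping of the result moves into the arrow type of the function.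
  For an abstraction, arrow inversion shrinks the domain, which only strengthens the assumption on
  the bound variable.\<close>

lemma types_of_sub: "T \<in> types_of M \<rho> \<Longrightarrow> ty T \<sqsubseteq>\<^sub>u ty T' \<Longrightarrow> T' \<in> types_of M \<rho>"
proof (induction M arbitrary: T T' \<rho>)
  case (Var x)
  then show ?case by (auto intro: sub_trans)
next
  case (App M N)
  then show ?case by simp (meson sub_arr sub_refl)
next
  case (Bind P)
  then obtain U S where S: "T = Arr U S" "S \<in> types_of P (case_nat U \<rho>)" by auto
  with Bind.prems obtain U' S' where S': "T' = Arr U' S'" "U' \<sqsubseteq>\<^sub>u U" "ty S \<sqsubseteq>\<^sub>u ty S'"
    by (auto elim: sub_ArrE)
  have "types_of P (case_nat U \<rho>) \<subseteq> types_of P (case_nat U' \<rho>)"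
    by (rule types_of_mono) (auto intro: sub_refl S' split: nat.splits)
  then have "S' \<in> types_of P (case_nat U' \<rho>)"
    using Bind.IH S S' by blast
  then show ?case using S' by simp
qed

lemma types_of_sub_fset: "fset U \<subseteq> types_of M \<rho> \<Longrightarrow> U \<sqsubseteq>\<^sub>u V \<Longrightarrow> fset V \<subseteq> types_of M \<rho>"
  by (metis subset_iff sub_componentE types_of_sub)

lemma fset_subset_types_of_Var: "fset U \<subseteq> types_of (Var x) \<rho> \<longleftrightarrow> \<rho> x \<sqsubseteq>\<^sub>u U"
  by (auto intro: sub_all sub_trans sub_member)

lemma types_of_rename: "types_of (rename f M) \<rho> = types_of M (\<lambda>i. \<rho> (f i))"
proof (induction M arbitrary: f \<rho>)
  case (Bind P)
  have "(\<lambda>i. case_nat U \<rho> (case_nat 0 (\<lambda>i. Suc (f i)) i)) = case_nat U (\<lambda>i. \<rho> (f i))" for U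
    by (auto split: nat.splits)
  then show ?case by (simp add: Bind)
qed auto

lemma types_of_lam: "types_of (lam x M) \<rho> = {Arr U T | U T. T \<in> types_of M (\<rho>(x := U))}"
proof -
  have "(\<lambda>i. case_nat U \<rho> (if i = x then 0 else Suc i)) = \<rho>(x := U)" for U
    by (rule ext) simp
  then show ?thesis by (simp add: lam_def types_of_rename)
qed


section \<open>Invariance under conversion\<close>

text \<open>The substitution lemma behind subject reduction. Under a binder index 0 keeps its type,
  and the shift by \<open>Suc\<close> skips the new entry of the environment.\<close>

lemma types_of_psubst:
  "T \<in> types_of M \<sigma> \<Longrightarrow> (\<And>x. fset (\<sigma> x) \<subseteq> types_of (s x) \<rho>) \<Longrightarrow> T \<in> types_of (psubst s M) \<rho>"
proof (induction M arbitrary: T \<sigma> \<rho> s)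
  case (Var x)
  then show ?case using types_of_sub_fset[of "\<sigma> x" "s x" \<rho> "ty T"] by auto
next
  case (App M N)
  then obtain U where U: "Arr U T \<in> types_of M \<sigma>" "fset U \<subseteq> types_of N \<sigma>" by auto
  have "Arr U T \<in> types_of (psubst s M) \<rho>" using U App by blast
  moreover have "fset U \<subseteq> types_of (psubst s N) \<rho>" using U App by blast
  ultimately show ?case by auto
next
  case (Bind P)
  then obtain U S where S: "T = Arr U S" "S \<in> types_of P (case_nat U \<sigma>)" by auto
  have "S \<in> types_of (psubst (case_nat (Var 0) (\<lambda>i. rename Suc (s i))) P) (case_nat U \<rho>)"
  proof (rule Bind.IH[OF S(2)])
    fix x
    show "fset (case_nat U \<sigma> x) \<subseteq>
        types_of (case_nat (Var 0) (\<lambda>i. rename Suc (s i)) x) (case_nat U \<rho>)"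
      using Bind.prems(2) by (cases x) (auto simp: types_of_rename intro: sub_member)
  qed
  then show ?case using S by simp
qed

text \<open>Each of the finitely many components brings its own \<open>\<sigma>\<close>; by
  monotonicity their pointwise intersection serves all of them.\<close>

lemma types_of_psubstE_fset:
  assumes "\<And>T. T |\<in>| U \<Longrightarrow> \<exists>\<sigma>. (\<forall>x. fset (\<sigma> x) \<subseteq> types_of (s x) \<rho>) \<and> T \<in> types_of M \<sigma>"
  shows "\<exists>\<sigma>. (\<forall>x. fset (\<sigma> x) \<subseteq> types_of (s x) \<rho>) \<and> fset U \<subseteq> types_of M \<sigma>"
  using assms
proof (induction U)
  case empty
  show ?case by (rule exI[of _ "\<lambda>_. {||}"]) auto
next
  case (insert T U)
  obtain \<sigma> where \<sigma>: "\<forall>x. fset (\<sigma> x) \<subseteq> types_of (s x) \<rho>" "T \<in> types_of M \<sigma>"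
    using insert.prems[of T] by auto
  obtain \<tau> where \<tau>: "\<forall>x. fset (\<tau> x) \<subseteq> types_of (s x) \<rho>" "fset U \<subseteq> types_of M \<tau>"
    using insert.IH[OF insert.prems[OF finsertI2]] by blast
  let ?\<mu> = "\<lambda>x. \<sigma> x |\<union>| \<tau> x"
  have "types_of M \<sigma> \<subseteq> types_of M ?\<mu>" "types_of M \<tau> \<subseteq> types_of M ?\<mu>"
    by (auto intro!: types_of_mono sub_fsubset)
  then show ?case using \<sigma> \<tau> by (intro exI[of _ ?\<mu>]) auto
qed

text \<open>The converse substitution lemma, behind subject expansion: \<open>\<sigma> x\<close>
  collects the types at which the copies of \<open>s x\<close> are used, and intersection lets them
  share one declaration.\<close>

lemma types_of_psubstE:
  "T \<in> types_of (psubst s M) \<rho> \<Longrightarrow>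
    \<exists>\<sigma>. (\<forall>x. fset (\<sigma> x) \<subseteq> types_of (s x) \<rho>) \<and> T \<in> types_of M \<sigma>"
proof (induction M arbitrary: T \<rho> s)
  case (Var x)
  then show ?case
    \<comment> \<open>The default \<open>\<omega>\<close> imposes no condition on the other
      variables.\<close>
    by (intro exI[of _ "(\<lambda>_. {||})(x := ty T)"]) (auto intro: sub_refl)
next
  case (App M N)
  then obtain U where U: "Arr U T \<in> types_of (psubst s M) \<rho>" "fset U \<subseteq> types_of (psubst s N) \<rho>"
    by auto
  obtain \<sigma> where \<sigma>: "\<forall>x. fset (\<sigma> x) \<subseteq> types_of (s x) \<rho>" "Arr U T \<in> types_of M \<sigma>"
    using App.IH(1)[OF U(1)] by blast
  obtain \<tau> where \<tau>: "\<forall>x. fset (\<tau> x) \<subseteq> types_of (s x) \<rho>" "fset U \<subseteq> types_of N \<tau>"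
    using types_of_psubstE_fset[of U s \<rho> N] App.IH(2) U(2) by blast
  let ?\<mu> = "\<lambda>x. \<sigma> x |\<union>| \<tau> x"
  have "types_of M \<sigma> \<subseteq> types_of M ?\<mu>" "types_of N \<tau> \<subseteq> types_of N ?\<mu>"
    by (auto intro!: types_of_mono sub_fsubset)
  then show ?case using \<sigma> \<tau> by (intro exI[of _ ?\<mu>]) (auto intro!: exI[of _ U])
next
  case (Bind P)
  let ?s = "case_nat (Var 0) (\<lambda>i. rename Suc (s i))"
  obtain U S where S: "T = Arr U S" "S \<in> types_of (psubst ?s P) (case_nat U \<rho>)"
    using Bind.prems by auto
  obtain \<sigma> where \<sigma>: "\<And>x. fset (\<sigma> x) \<subseteq> types_of (?s x) (case_nat U \<rho>)" "S \<in> types_of P \<sigma>"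
    using Bind.IH[OF S(2)] by blast
  \<comment> \<open>The bound index is substituted by itself, so its type in \<open>\<sigma>\<close>
    is at best a weakening of \<open>U\<close> and can be replaced by \<open>U\<close>.\<close>
  have "U \<sqsubseteq>\<^sub>u \<sigma> 0"
    using \<sigma>(1)[of 0] fset_subset_types_of_Var[of "\<sigma> 0" 0 "case_nat U \<rho>"] by simp
  then have "types_of P \<sigma> \<subseteq> types_of P (case_nat U (\<lambda>i. \<sigma> (Suc i)))"
    by (intro types_of_mono) (auto intro: sub_refl split: nat.splits)
  moreover have "fset (\<sigma> (Suc x)) \<subseteq> types_of (s x) \<rho>" for x
    using \<sigma>(1)[of "Suc x"] by (simp add: types_of_rename)
  ultimately show ?case using S(1) \<sigma>(2) by (intro exI[of _ "\<lambda>i. \<sigma> (Suc i)"]) auto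
qed

lemma types_of_redex: "types_of (App (lam x M) N) \<rho> = types_of (M[x ::= N]) \<rho>"
proof (intro equalityI subsetI)
  fix T assume "T \<in> types_of (App (lam x M) N) \<rho>"
  then obtain U where U: "T \<in> types_of M (\<rho>(x := U))" "fset U \<subseteq> types_of N \<rho>"
    by (auto simp: types_of_lam)
  show "T \<in> types_of (M[x ::= N]) \<rho>"
    unfolding subst_def
    by (rule types_of_psubst[OF U(1)]) (use U(2) in \<open>auto intro: sub_member\<close>)
next
  fix T assume "T \<in> types_of (M[x ::= N]) \<rho>"
  then obtain \<sigma> where \<sigma>: "\<And>y. fset (\<sigma> y) \<subseteq> types_of ((Var(x := N)) y) \<rho>" "T \<in> types_of M \<sigma>"
    unfolding subst_def by (blast dest: types_of_psubstE)
  \<comment> \<open>Away from \<open>x\<close> the substitution is the identity, so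
    \<open>\<sigma>\<close> can be strengthened to \<open>\<rho>\<close> there;
    \<open>\<sigma> x\<close> then becomes the domain of the arrow type of the abstraction.\<close>
  have "\<rho> y \<sqsubseteq>\<^sub>u \<sigma> y" if "y \<noteq> x" for y
    using \<sigma>(1)[of y] that fset_subset_types_of_Var[of "\<sigma> y" y \<rho>] by simp
  then have "types_of M \<sigma> \<subseteq> types_of M (\<rho>(x := \<sigma> x))"
    by (intro types_of_mono) (auto intro: sub_refl)
  moreover have "fset (\<sigma> x) \<subseteq> types_of N \<rho>" using \<sigma>(1)[of x] by simp
  ultimately show "T \<in> types_of (App (lam x M) N) \<rho>"
    using \<sigma>(2) by (auto simp: types_of_lam)
qed

lemma types_of_beta: "beta M N \<Longrightarrow> types_of M \<rho> = types_of N \<rho>"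
proof (induction arbitrary: \<rho> rule: beta.induct)
  case (beta_redex x M N)
  show ?case by (rule types_of_redex)
qed (auto simp: types_of_lam)

lemma types_of_betas: "beta\<^sup>*\<^sup>* M N \<Longrightarrow> types_of M \<rho> = types_of N \<rho>"
  by (induction rule: rtranclp_induct) (auto dest: types_of_beta)

lemma whead_imp_beta: "whead M N \<Longrightarrow> beta M N"
proof -
  have "beta (foldl App M Qs) (foldl App N Qs)" if "beta M N" for M N Qs
    using that by (induction Qs arbitrary: M N) (auto intro: beta_appL)
  then show "whead M N \<Longrightarrow> beta M N" unfolding whead_def by (blast intro: beta_redex)
qed

lemma types_of_steps: "steps r M N \<Longrightarrow> types_of M \<rho> = types_of N \<rho>"
  by (induction rule: rtranclp_induct; cases r) (auto dest: types_of_beta whead_imp_beta)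


section \<open>Typing judgements and the filter of types\<close>

definition env_fun :: "env \<Rightarrow> nat \<Rightarrow> uty" where
  "env_fun \<Gamma> x = (case fmlookup \<Gamma> x of None \<Rightarrow> \<omega> | Some U \<Rightarrow> U)"

text \<open>Restores the domain that \<open>env_fun\<close> forgets: a derivable judgement declares
  exactly the free variables of its term.\<close>

definition env_of :: "(nat \<Rightarrow> uty) \<Rightarrow> trm \<Rightarrow> env" where
  "env_of \<rho> M = fmmap_keys (\<lambda>x _. \<rho> x) (env_omega M)"

lemma fmlookup_env_of: "fmlookup (env_of \<rho> M) x = (if x \<in> fv M then Some (\<rho> x) else None)"
  by (simp add: env_of_def env_omega.rep_eq)

lemma env_of_omega: "env_of (\<lambda>_. \<omega>) M = env_omega M"
  by (rule fmap_ext) (simp add: fmlookup_env_of env_omega.rep_eq)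

lemma env_of_env_fun: "fset (fmdom \<Gamma>) = fv M \<Longrightarrow> env_of (env_fun \<Gamma>) M = \<Gamma>"
proof (rule fmap_ext)
  fix x assume "fset (fmdom \<Gamma>) = fv M"
  then have "x \<in> fv M \<longleftrightarrow> x |\<in>| fmdom \<Gamma>" by auto
  then show "fmlookup (env_of (env_fun \<Gamma>) M) x = fmlookup \<Gamma> x"
    by (auto simp: fmlookup_env_of env_fun_def fmlookup_dom_iff split: option.splits)
qed

lemma env_fun_omega: "env_fun (env_omega M) = (\<lambda>_. \<omega>)"
  by (rule ext) (simp add: env_fun_def env_omega.rep_eq)

lemma fmdom_env_omega: "fset (fmdom (env_omega M)) = fv M"
  by (auto simp: fmlookup_dom_iff env_omega.rep_eq split: if_splits)

lemma fmdom_env_inter: "fset (fmdom (\<Gamma> \<sqinter>\<^sub>e \<Delta>)) = fset (fmdom \<Gamma>) \<union> fset (fmdom \<Delta>)"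
  by (auto simp: fmlookup_dom_iff env_inter.rep_eq split: option.splits)

lemma env_fun_inter: "env_fun (\<Gamma> \<sqinter>\<^sub>e \<Delta>) x = env_fun \<Gamma> x |\<union>| env_fun \<Delta> x"
  by (auto simp: env_fun_def env_inter.rep_eq split: option.splits)

lemma sub_env_fun: "\<Gamma> \<sqsubseteq>\<^sub>e \<Delta> \<Longrightarrow> fmdom \<Gamma> = fmdom \<Delta> \<and> (\<forall>x. env_fun \<Gamma> x \<sqsubseteq>\<^sub>u env_fun \<Delta> x)"
proof (induction rule: sub_env.induct)
  case (sub_env_trans \<Gamma>1 \<Gamma>2 \<Gamma>3)
  then show ?case by (metis sub_trans)
qed (auto simp: env_fun_def intro: sub_refl)

lemma sub_env_fmupd: "\<Gamma> \<sqsubseteq>\<^sub>e \<Delta> \<Longrightarrow> x |\<notin>| fmdom \<Gamma> \<Longrightarrow> fmupd x U \<Gamma> \<sqsubseteq>\<^sub>e fmupd x U \<Delta>"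
proof (induction rule: sub_env.induct)
  case (sub_env_trans \<Gamma>1 \<Gamma>2 \<Gamma>3)
  then show ?case using sub_env_fun sub_env.sub_env_trans by metis
next
  case (sub_env_upd U1 U2 y \<Gamma>)
  then have "x \<noteq> y" by auto
  then show ?case
    using sub_env.sub_env_upd[of U1 U2 y "fmupd x U \<Gamma>"] sub_env_upd by (simp add: fmupd_reorder_neq)
qed (rule sub_env_refl)

text \<open>The subtyping rule for environments changes one declaration at a time, so a pointwise
  comparison is turned into a chain of such changes by induction on the map.\<close>

lemma sub_env_fmmap_keys:
  fixes \<Gamma> :: env
  shows "(\<And>x. \<rho> x \<sqsubseteq>\<^sub>u \<sigma> x) \<Longrightarrow> fmmap_keys (\<lambda>x _. \<rho> x) \<Gamma> \<sqsubseteq>\<^sub>e fmmap_keys (\<lambda>x _. \<sigma> x) \<Gamma>"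
proof (induction \<Gamma> rule: fmap_induct)
  case fmempty
  have "fmmap_keys f fmempty = fmempty" for f :: "nat \<Rightarrow> uty \<Rightarrow> uty" by (rule fmap_ext) simp
  then show ?case by (simp add: sub_env_refl)
next
  case (fmupd x U \<Gamma>)
  have upd: "fmmap_keys (\<lambda>x _. \<tau> x) (fmupd x U \<Gamma>) = fmupd x (\<tau> x) (fmmap_keys (\<lambda>x _. \<tau> x) \<Gamma>)"
    for \<tau> :: "nat \<Rightarrow> uty" by (rule fmap_ext) simp
  show ?case unfolding upd
    by (rule sub_env_trans[OF sub_env_upd sub_env_fmupd]) (use fmupd in \<open>auto simp: fmlookup_dom_iff\<close>)
qed

lemma sub_typing_components:
  "\<Phi> \<sqsubseteq>\<^sub>t \<Psi> \<Longrightarrow> snd \<Phi> \<sqsubseteq>\<^sub>u snd \<Psi> \<and> fst \<Psi> \<sqsubseteq>\<^sub>e fst \<Phi>"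
proof (induction rule: sub_typing.induct)
  case (sub_typing_trans \<Phi>1 \<Phi>2 \<Phi>3)
  then show ?case by (meson sub_trans sub_env_trans)
qed (auto intro: sub_refl sub_env_refl)

section \<open>Equivalence of derivability and membership in the filter\<close>

lemma typing_sound_types_of:
  "M : \<langle>\<Gamma> \<turnstile> U\<rangle> \<Longrightarrow> fset (fmdom \<Gamma>) = fv M \<and> fset U \<subseteq> types_of M (env_fun \<Gamma>)"
proof (induction rule: typing.induct)
  case (typing_ax x T)
  show ?case by (auto simp: env_fun_def intro: sub_refl)
next
  case (typing_omega M)
  show ?case by (simp add: fmdom_env_omega)
next
  case (typing_arrI M x U \<Gamma> T)
  have "env_fun (fmupd x U \<Gamma>) = (env_fun \<Gamma>)(x := U)" by (rule ext) (simp add: env_fun_def)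
  then show ?case using typing_arrI by (auto simp: types_of_lam fv_lam simp del: fun_upd_apply)
next
  case (typing_arrI' M \<Gamma> T x)
  \<comment> \<open>An undeclared variable already reads as \<open>\<omega>\<close>, so this rule is
    the abstraction clause at \<open>U = \<omega>\<close>.\<close>
  have "(env_fun \<Gamma>)(x := \<omega>) = env_fun \<Gamma>"
    using typing_arrI'.hyps by (intro ext) (auto simp: env_fun_def fmlookup_dom_iff split: option.splits)
  then show ?case using typing_arrI' by (auto simp: types_of_lam fv_lam)
next
  case (typing_arrE M1 \<Gamma>1 U T M2 \<Gamma>2)
  let ?\<Gamma> = "\<Gamma>1 \<sqinter>\<^sub>e \<Gamma>2"
  have "types_of M1 (env_fun \<Gamma>1) \<subseteq> types_of M1 (env_fun ?\<Gamma>)"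
    "types_of M2 (env_fun \<Gamma>2) \<subseteq> types_of M2 (env_fun ?\<Gamma>)"
    by (auto simp: env_fun_inter intro!: types_of_mono sub_fsubset)
  then show ?case using typing_arrE.IH by (auto simp: fmdom_env_inter intro!: exI[of _ U])
next
  case (typing_interI M \<Gamma> U1 U2)
  then show ?case by auto
next
  case (typing_sub M \<Gamma> U \<Gamma>' U')
  then have "U \<sqsubseteq>\<^sub>u U'" and "fmdom \<Gamma>' = fmdom \<Gamma>" and "\<forall>x. env_fun \<Gamma>' x \<sqsubseteq>\<^sub>u env_fun \<Gamma> x"
    using sub_typing_components[of "(\<Gamma>, U)" "(\<Gamma>', U')"] sub_env_fun by auto
  then show ?case
    using typing_sub.IH types_of_sub_fset types_of_mono[of M "env_fun \<Gamma>'" "env_fun \<Gamma>"]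
    by (metis subset_trans)
qed

lemma typing_env_of_fset:
  "(\<And>T. T |\<in>| U \<Longrightarrow> M : \<langle>env_of \<rho> M \<turnstile> ty T\<rangle>) \<Longrightarrow> M : \<langle>env_of \<rho> M \<turnstile> U\<rangle>"
proof (induction U)
  case empty
  \<comment> \<open>The rule for \<open>\<omega>\<close> provides only the environment
    \<open>env_omega M\<close>; subtyping then strengthens its declarations to those of
    \<open>\<rho>\<close>.\<close>
  have "env_of \<rho> M \<sqsubseteq>\<^sub>e env_of (\<lambda>_. \<omega>) M"
    unfolding env_of_def by (rule sub_env_fmmap_keys) (auto intro: sub_fsubset)
  then show ?case
    by (metis env_of_omega sub_refl sub_typing_pair typing_omega typing_sub)
next
  case (insert T U)
  have "M : \<langle>env_of \<rho> M \<turnstile> ty T \<sqinter>\<^sub>u U\<rangle>"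
    by (intro typing_interI insert.IH insert.prems) auto
  then show ?case by simp
qed

text \<open>Induction is on size: the typing rules use named abstraction, whose body is a renaming
  of the de Bruijn body and not a structural subterm.\<close>

lemma typing_complete_types_of: "T \<in> types_of M \<rho> \<Longrightarrow> M : \<langle>env_of \<rho> M \<turnstile> ty T\<rangle>"
proof (induction "size M" arbitrary: M T \<rho> rule: less_induct)
  case less
  consider x where "M = Var x" | M1 M2 where "M = App M1 M2" | x P where "M = lam x P"
    by (rule trm_named_exhaust[OF finite.emptyI, of M])
  then show ?case
  proof cases
    case 1
    have "env_of \<rho> (Var x) = fmupd x (\<rho> x) fmempty" by (rule fmap_ext) (simp add: fmlookup_env_of)
    moreover have "fmupd x (\<rho> x) fmempty \<sqsubseteq>\<^sub>e fmupd x (ty T) fmempty"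
      using less.prems 1 by (intro sub_env_upd) auto
    ultimately show ?thesis
      using 1 by (metis sub_refl sub_typing_pair typing_ax typing_sub)
  next
    case 2
    then obtain U where U: "Arr U T \<in> types_of M1 \<rho>" "fset U \<subseteq> types_of M2 \<rho>"
      using less.prems by auto
    have "M1 : \<langle>env_of \<rho> M1 \<turnstile> ty (Arr U T)\<rangle>" using less.hyps 2 U by simp
    moreover have "M2 : \<langle>env_of \<rho> M2 \<turnstile> U\<rangle>"
      by (rule typing_env_of_fset) (use less.hyps 2 U in auto)
    moreover have "env_of \<rho> M1 \<sqinter>\<^sub>e env_of \<rho> M2 = env_of \<rho> M"
      using 2 by (intro fmap_ext) (simp add: fmlookup_env_of env_inter.rep_eq)
    ultimately show ?thesis using 2 by (metis typing_arrE)
  next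
    case 3
    then obtain U S where S: "T = Arr U S" "S \<in> types_of P (\<rho>(x := U))"
      using less.prems by (auto simp: types_of_lam)
    have size_rename: "size (rename f Q) = size Q" for f Q by (induction Q arbitrary: f) auto
    then have "size P < size M" using 3 by (simp add: lam_def)
    then have P: "P : \<langle>env_of (\<rho>(x := U)) P \<turnstile> ty S\<rangle>" using less.hyps S by blast
    have x: "x |\<notin>| fmdom (env_of \<rho> M)" using 3 by (auto simp: fmlookup_dom_iff fmlookup_env_of fv_lam)
    show ?thesis
    proof (cases "x \<in> fv P")
      case True
      have "env_of (\<rho>(x := U)) P = fmupd x U (env_of \<rho> M)"
        using True 3 by (intro fmap_ext) (auto simp: fmlookup_env_of fv_lam)
      then show ?thesis using P x 3 S by (auto intro: typing_arrI)
    next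
      case False
      have "env_of (\<rho>(x := U)) P = env_of \<rho> M"
        using False 3 by (intro fmap_ext) (auto simp: fmlookup_env_of fv_lam)
      \<comment> \<open>Since \<open>x\<close> is not declared, only \<open>Arr \<omega> S\<close>
        can be introduced; contravariance and \<open>U\<close> below \<open>\<omega>\<close> then
        give \<open>Arr U S\<close>.\<close>
      then have "M : \<langle>env_of \<rho> M \<turnstile> ty (Arr \<omega> S)\<rangle>" using P x 3 by (auto intro: typing_arrI')
      moreover have "ty (Arr \<omega> S) \<sqsubseteq>\<^sub>u ty T" using S by (auto intro: sub_arr sub_refl sub_fsubset)
      ultimately show ?thesis by (blast intro: typing_sub sub_typing_pair sub_env_refl)
    qed
  qed
qed

lemma typing_iff_types_of:
  "M : \<langle>\<Gamma> \<turnstile> U\<rangle> \<longleftrightarrow> fset (fmdom \<Gamma>) = fv M \<and> fset U \<subseteq> types_of M (env_fun \<Gamma>)"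
proof
  assume *: "fset (fmdom \<Gamma>) = fv M \<and> fset U \<subseteq> types_of M (env_fun \<Gamma>)"
  then have "M : \<langle>env_of (env_fun \<Gamma>) M \<turnstile> U\<rangle>"
    using typing_env_of_fset typing_complete_types_of by blast
  then show "M : \<langle>\<Gamma> \<turnstile> U\<rangle>" using * by (simp add: env_of_env_fun)
qed (rule typing_sound_types_of)

lemma typing_env_omega_iff: "M : \<langle>env_omega M \<turnstile> U\<rangle> \<longleftrightarrow> fset U \<subseteq> types_of M (\<lambda>_. \<omega>)"
  by (simp add: typing_iff_types_of fmdom_env_omega env_fun_omega)


section \<open>Soundness\<close>

lemma psubst_psubst: "psubst t (psubst s M) = psubst (\<lambda>i. psubst t (s i)) M"
  by (induction M arbitrary: s t)
    (auto simp: psubst_rename rename_psubst intro!: psubst_cong split: nat.splits)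

lemma psubst_Var: "psubst Var M = M"
  using psubst_Var_rename[of "\<lambda>i. i" M] by (simp add: rename_ident)

lemma whead_Bind: "whead (App (Bind P) N) (psubst (case_nat N Var) P)"
proof -
  \<comment> \<open>Head reduction is stated with named abstraction, so the bound index is given a
    fresh name.\<close>
  obtain x where x: "x \<notin> fv (Bind P)" using ex_new_if_finite[OF infinite_UNIV_nat finite_fv] by blast
  let ?Q = "rename (case_nat x (\<lambda>i. i)) P"
  have "rename (\<lambda>i. i) P = rename (\<lambda>i. if case_nat x (\<lambda>i. i) i = x then 0 else Suc (case_nat x (\<lambda>i. i) i)) P"
    by (rule rename_cong) (use x in \<open>auto split: nat.splits\<close>)
  then have "Bind P = lam x ?Q" by (simp add: lam_def rename_rename rename_ident)
  moreover have "psubst (case_nat N Var) P = ?Q[x ::= N]"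
    unfolding subst_def psubst_rename
    by (rule psubst_cong) (use x in \<open>auto split: nat.splits\<close>)
  ultimately show ?thesis
    unfolding whead_def by (intro exI[of _ x] exI[of _ ?Q] exI[of _ N] exI[of _ "[]"]) simp
qed

lemma step_Bind: "step r (App (Bind P) N) (psubst (case_nat N Var) P)"
  by (cases r) (auto intro: whead_Bind whead_imp_beta)

text \<open>For head reduction the new argument joins the end of the spine \<open>Qs\<close>. This
  is what carries saturation over to arrow types.\<close>

lemma step_App: "step r M N \<Longrightarrow> step r (App M Q) (App N Q)"
proof (cases r)
  case F
  assume "step r M N"
  then obtain x P R Qs where eq: "M = foldl App (App (lam x P) R) Qs" "N = foldl App (P[x ::= R]) Qs"
    using F by (auto simp: whead_def)
  show ?thesis
    unfolding F step.simps whead_def eq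
    by (rule exI[of _ x], rule exI[of _ P], rule exI[of _ R], rule exI[of _ "Qs @ [Q]"]) simp
qed (auto intro: beta_appL)

lemma steps_App: "steps r M N \<Longrightarrow> steps r (App M Q) (App N Q)"
  by (induction rule: rtranclp_induct) (auto intro: step_App rtranclp.rtrancl_into_rtrancl)

section \<open>Saturation and adequacy of interpretations\<close>

lemma saturated_interp_tty: "interpretation_for r I \<Longrightarrow> saturated r (interp_tty I T)"
proof (induction T)
  case (Arr U T)
  then have "saturated r (interp_tty I T)" by blast
  then have "App M Q \<in> interp_tty I T" if "steps r M N" "App N Q \<in> interp_tty I T" for M N Q
    using steps_App[OF that(1)] that(2) unfolding saturated_def by blast
  then show ?case
    by (auto simp: saturated_def arrow_def)
qed (simp add: interpretation_for_def)

lemma interp_iff: "M \<in> interp I U \<longleftrightarrow> (\<forall>T. T |\<in>| U \<longrightarrow> M \<in> interp_tty I T)"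
  by (auto simp: interp_def)

lemma interp_tty_Arr: "interp_tty I (Arr U T) = interp I U \<leadsto> interp_tty I T"
  by (simp add: interp_def)

lemma interp_sub: "U \<sqsubseteq>\<^sub>u V \<Longrightarrow> interp I U \<subseteq> interp I V"
proof (induction rule: sub.induct)
  case (sub_arr U2 U1 T1 T2)
  then show ?case by (auto simp: interp_simps(4) arrow_def)
qed (auto simp: interp_simps)

text \<open>Adequacy for open terms: the induction needs an arbitrary substitution \<open>s\<close>
  realising \<open>\<rho>\<close>, because a binder adds an arbitrary argument to it.\<close>

lemma types_of_interp:
  assumes I: "interpretation_for r I"
  shows "T \<in> types_of M \<rho> \<Longrightarrow> (\<And>x. s x \<in> interp I (\<rho> x)) \<Longrightarrow> psubst s M \<in> interp_tty I T"
proof (induction M arbitrary: T \<rho> s)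
  case (Var x)
  then have "s x \<in> interp I (ty T)" using interp_sub[of "\<rho> x" "ty T" I] by auto
  then show ?case by (simp add: interp_def)
next
  case (App M N)
  then obtain U where U: "Arr U T \<in> types_of M \<rho>" "fset U \<subseteq> types_of N \<rho>" by auto
  have "psubst s M \<in> interp_tty I (Arr U T)" using App U by blast
  moreover have "psubst s N \<in> interp I U" unfolding interp_iff using App U by blast
  ultimately show ?case unfolding interp_tty_Arr arrow_def by simp
next
  case (Bind P)
  then obtain U S where S: "T = Arr U S" "S \<in> types_of P (case_nat U \<rho>)" by auto
  let ?P = "psubst (case_nat (Var 0) (\<lambda>i. rename Suc (s i))) P"
  have "App (Bind ?P) N \<in> interp_tty I S" if N: "N \<in> interp I U" for N
  proof -
    \<comment> \<open>Contracting the redex extends \<open>s\<close> by \<open>N\<close>; the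
      induction hypothesis applies to the contractum, and saturation carries membership back to the
      application.\<close>
    have "psubst (case_nat N Var) ?P = psubst (case_nat N s) P"
      unfolding psubst_psubst
      by (rule psubst_cong) (auto simp: psubst_rename psubst_Var split: nat.splits)
    moreover have "psubst (case_nat N s) P \<in> interp_tty I S"
      by (rule Bind.IH[OF S(2)]) (use N Bind.prems(2) in \<open>auto split: nat.splits\<close>)
    ultimately show ?thesis
      using saturated_interp_tty[OF I, of S] step_Bind[of r ?P N] unfolding saturated_def
      by (metis r_into_rtranclp)
  qed
  then show ?case unfolding S(1) interp_tty_Arr arrow_def by simp
qed

lemma types_of_imp_meaning: "fset U \<subseteq> types_of M (\<lambda>_. \<omega>) \<Longrightarrow> M \<in> meaning r U"
  unfolding meaning_def
  \<comment> \<open>The identity substitution realises the all-\<open>\<omega>\<close> environment,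
    since \<open>\<omega>\<close> denotes all terms.\<close>
  using types_of_interp[of r _ _ M "\<lambda>_. \<omega>" Var]
  by (auto simp: interp_iff psubst_Var subset_iff)


section \<open>Completeness\<close>

instance raw_tty :: countable by countable_datatype
instance raw_uty :: countable by countable_datatype

text \<open>Types are images of raw syntax trees, of which there are countably many; hence the
  variables suffice to carry every type.\<close>

lemma ex_surj_uty: "\<exists>g :: nat \<Rightarrow> uty. surj g"
proof
  have "surj (from_nat :: nat \<Rightarrow> raw_uty)" by simp
  then show "surj (uty_of \<circ> from_nat)" using uty_of_surj by (intro comp_surj)
qed

lemma interp_term_model:
  assumes "surj \<rho>"
  shows "interp_tty (\<lambda>a. {M. Atom a \<in> types_of M \<rho>}) T = {M. T \<in> types_of M \<rho>}"
    (is "interp_tty ?I T = _")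
proof (induction T)
  case (Arr U T)
  have U: "interp ?I U = {M. fset U \<subseteq> types_of M \<rho>}"
    using Arr.IH(1) by (auto simp: interp_iff)
  obtain x where x: "\<rho> x = U" using assms by (metis surjD)
  have "Arr U T \<in> types_of M \<rho>" if M: "M \<in> interp_tty ?I (Arr U T)" for M
  proof -
    have "Var x \<in> interp ?I U" using x by (simp add: U fset_subset_types_of_Var sub_refl del: types_of.simps)
    then have "T \<in> types_of (App M (Var x)) \<rho>"
      using M Arr.IH(2) unfolding interp_tty_Arr arrow_def by blast
    \<comment> \<open>Typability of the application yields some domain \<open>V\<close> accepted by
      \<open>Var x\<close>, hence above \<open>U\<close>; contravariance turns \<open>V\<close> into
      \<open>U\<close>.\<close>
    then obtain V where "Arr V T \<in> types_of M \<rho>" "U \<sqsubseteq>\<^sub>u V"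
      using x fset_subset_types_of_Var by auto
    then show ?thesis by (blast intro: types_of_sub sub_arr sub_refl)
  qed
  moreover have "M \<in> interp_tty ?I (Arr U T)" if "Arr U T \<in> types_of M \<rho>" for M
    using that unfolding interp_tty_Arr arrow_def U by (auto simp: Arr.IH(2))
  ultimately show ?case by blast
qed simp

lemma meaning_imp_types_of:
  assumes "M \<in> meaning r U"
  shows "fset U \<subseteq> types_of M (\<lambda>_. \<omega>)"
proof -
  obtain k where k: "\<And>x. x \<in> fv M \<Longrightarrow> x < k"
    using finite_nat_set_iff_bounded finite_fv by metis
  obtain g :: "nat \<Rightarrow> uty" where g: "surj g" using ex_surj_uty by blast
  \<comment> \<open>The bound \<open>k\<close> exceeds all free variables of \<open>M\<close>, which
    thus get \<open>\<omega>\<close>; the shifted \<open>g\<close> still reaches every type on the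
    variables from \<open>k\<close> on.\<close>
  let ?\<rho> = "\<lambda>x. if x < k then \<omega> else g (x - k)"
  let ?I = "\<lambda>a. {M. Atom a \<in> types_of M ?\<rho>}"
  have "surj ?\<rho>"
  proof (rule surjI)
    show "?\<rho> (inv g V + k) = V" for V using g by (simp add: surj_f_inv_f)
  qed
  \<comment> \<open>Saturation holds for both reductions because the filter is invariant under
    either kind of step.\<close>
  moreover have "interpretation_for r ?I"
    unfolding interpretation_for_def saturated_def using types_of_steps by blast
  then have "M \<in> interp ?I U" using assms unfolding meaning_def by blast
  ultimately have "fset U \<subseteq> types_of M ?\<rho>"
    using interp_term_model by (auto simp: interp_iff)
  also have "types_of M ?\<rho> = types_of M (\<lambda>_. \<omega>)" by (rule types_of_cong) (simp add: k)
  finally show ?thesis .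
qed

theorem theorem5p2:
  fixes r :: red and U :: uty
  shows "meaning r U = {M. M : \<langle>env_omega M \<turnstile> U\<rangle>}
    \<and> (\<forall>M N. M \<in> meaning r U \<longrightarrow> beta\<^sup>*\<^sup>* M N \<longrightarrow> N \<in> meaning r U)
    \<and> (\<forall>M N. M \<in> meaning r U \<longrightarrow> beta\<^sup>*\<^sup>* N M \<longrightarrow> N \<in> meaning r U)
    \<and> meaning r U = {M. \<exists>N. beta\<^sup>*\<^sup>* M N \<and> N : \<langle>env_omega N \<turnstile> U\<rangle>}"
proof -
  have meaning: "meaning r U = {M. fset U \<subseteq> types_of M (\<lambda>_. \<omega>)}"
    using types_of_imp_meaning meaning_imp_types_of by blast
  \<comment> \<open>All four claims now concern one filter: stability is its invariance under
    conversion, and the last claim combines invariance with the choice \<open>N = M\<close>.\<close>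
  show ?thesis
    unfolding meaning typing_env_omega_iff
    using types_of_betas by auto
qed

end
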